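(* Let $p>0$ and $0<\epsilon\le p/3$, and let $a=(a_j)_{j\ge1}\in\mathcal F(\tfrac{2p}{3}+\epsilon;\,p)$. Then the limit $\lim_{n\to\infty}\frac{c_n}{c_{n+1}}$ exists and is positive.
   Context: For $0<p_1\le p_2$, $\mathcal F(p_1;p_2)$ is the set of sequences $(a_j)_{j\ge1}$ of positive reals such that $\lim_{n\to\infty}a_n/a_{n+1}=1$ and there are constants $\gamma_1,\gamma_2>0$ with $\gamma_1 j^{p_1-1}\le a_j\le\gamma_2 j^{p_2-1}$ for all sufficiently large $j$. For a positive sequence $(a_j)$, $c_n=\sum \frac{a_1^{n_1}a_2^{n_2}\cdots a_n^{n_n}}{n_1!\,n_2!\cdots n_n!}$, the sum being over all tuples $(n_1,\dots,n_n)$ of nonnegative integers with $\sum_{k=1}^n kn_k=n$; equivalently $\sum_{n\ge0}c_nx^n=\exp\big(\sum_{n\ge1}a_nx^n\big)$ as formal power series, with $c_0=1$. *)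

theory Defs
  imports "HOL-Analysis.Analysis"
begin

text \<open>
  A sequence \<open>(a\<^sub>j)\<close> with \<open>j \<ge> 1\<close> is a function \<open>nat \<Rightarrow> real\<close> whose value at \<open>0\<close> is
  never used. The class is only meant for \<open>0 < p\<^sub>1 \<le> p\<^sub>2\<close>.
\<close>

definition seq_class :: "real \<Rightarrow> real \<Rightarrow> (nat \<Rightarrow> real) set" where
  "seq_class p\<^sub>1 p\<^sub>2 = {a. (\<forall>j\<ge>1. a j > 0) \<and>
     (\<lambda>n. a n / a (n + 1)) \<longlonglongrightarrow> 1 \<and>
     (\<exists>\<gamma>\<^sub>1>0. \<exists>\<gamma>\<^sub>2>0. \<forall>\<^sub>F j in sequentially.
        \<gamma>\<^sub>1 * real j powr (p\<^sub>1 - 1) \<le> a j \<and> a j \<le> \<gamma>\<^sub>2 * real j powr (p\<^sub>2 - 1))}"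

text \<open>
  A tuple \<open>(n\<^sub>1, \<dots>, n\<^sub>n)\<close> is an extensional function on \<open>{1..n}\<close>, so each tuple is
  represented exactly once.
\<close>

definition weight_tuples :: "nat \<Rightarrow> (nat \<Rightarrow> nat) set" where
  "weight_tuples n = {m \<in> {1..n} \<rightarrow>\<^sub>E UNIV. (\<Sum>k=1..n. k * m k) = n}"

definition exp_coeff :: "(nat \<Rightarrow> real) \<Rightarrow> nat \<Rightarrow> real" where
  "exp_coeff a n =
     (\<Sum>m\<in>weight_tuples n. (\<Prod>k=1..n. a k ^ m k) / (\<Prod>k=1..n. fact (m k)))"

lemma finite_weight_tuples: "finite (weight_tuples n)"
proof (rule finite_subset)
  show "weight_tuples n \<subseteq> {1..n} \<rightarrow>\<^sub>E {..n}"
  proof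
    fix m assume "m \<in> weight_tuples n"
    then have ext: "m \<in> {1..n} \<rightarrow>\<^sub>E UNIV" and eq: "(\<Sum>k=1..n. k * m k) = n"
      by (auto simp: weight_tuples_def)
    have "m k \<le> n" if k: "k \<in> {1..n}" for k
    proof -
      have "m k \<le> k * m k" using k by simp
      also have "\<dots> \<le> (\<Sum>k=1..n. k * m k)"
        by (rule member_le_sum) (use k in auto)
      also note eq
      finally show ?thesis .
    qed
    with ext show "m \<in> {1..n} \<rightarrow>\<^sub>E {..n}" by (auto simp: PiE_iff)
  qed
qed (auto intro: finite_PiE)

lemma exp_coeff_0: "exp_coeff a 0 = 1"
  by (simp add: exp_coeff_def weight_tuples_def)

end

theory Submission
  imports Defs "HOL-Complex_Analysis.Complex_Analysis" "HOL-Real_Asymp.Real_Asymp"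
begin

text \<open>
  The limit is \<open>1\<close>, by a saddle point argument. Put \<open>F(z) = exp (\<Sum>k. a\<^sub>k z\<^sup>k)\<close> and \<open>r = exp (-\<sigma>)\<close>, where
  \<open>\<sigma> > 0\<close> solves \<open>(\<Sum>k. k a\<^sub>k r\<^sup>k) = n\<close>; then \<open>\<sigma> \<rightarrow> 0\<close> as \<open>n \<rightarrow> \<infinity>\<close>. Because the \<open>a\<^sub>k\<close> are real,
  \<open>\<pi> c\<^sub>m r\<^sup>m\<close> is the integral over \<open>[0, \<pi>]\<close> of the real part of \<open>F(r e\<^sup>i\<^sup>\<theta>) e\<^sup>-\<^sup>i\<^sup>m\<^sup>\<theta>\<close>. Let
  \<open>\<tau> = \<sigma> powr (1 + p/3 + \<epsilon>/4)\<close> and \<open>\<beta> = \<sigma> powr (1 + p/2)\<close>, and divide everything by \<open>F(r)\<close>.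
  For \<open>m = n\<close> the phase is at most \<open>\<theta>\<^sup>3/6 (\<Sum>k. k\<^sup>3 a\<^sub>k r\<^sup>k)\<close>, which is negligible on \<open>[0, \<tau>]\<close>, and
  on \<open>[0, \<beta>]\<close> the modulus of the integrand is bounded below. On \<open>[\<tau>, \<pi>]\<close> the modulus is at most
  \<open>exp (-T)\<close> with \<open>T\<close> a multiple of \<open>\<sigma> powr (-\<epsilon>/2)\<close>. Hence the integral for \<open>m = n\<close> is at least a
  constant times \<open>\<beta>\<close>, whereas the integrals for \<open>n + 1\<close> and \<open>n\<close> differ by \<open>O(\<tau>\<^sup>2 + exp (-T)) = o(\<beta>)\<close>.
  Negligible phase on \<open>[0, \<tau>]\<close> and decay beyond \<open>\<tau>\<close> are compatible exactly because the lower
  exponent exceeds \<open>2p/3\<close>.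
\<close>

section \<open>The recurrence for the coefficients\<close>

lemma exp_coeff_altdef:
  "exp_coeff a n = (\<Sum>m\<in>weight_tuples n. \<Prod>k=1..n. a k ^ m k / fact (m k))"
  by (simp add: exp_coeff_def prod_dividef)

text \<open>Taking away one part of size \<open>k\<close> is a bijection from the tuples with
  \<open>m k > 0\<close> onto the tuples of weight \<open>n - k\<close>. The factor
  \<open>m k\<close> turns \<open>1 / fact (m k)\<close> into \<open>1 / fact (m k - 1)\<close>, and
  one factor \<open>a k\<close> is split off.\<close>

lemma sum_weight_tuples_mult_part:
  assumes k: "k \<in> {1..n}"
  shows "(\<Sum>m\<in>weight_tuples n. real (m k) * (\<Prod>j=1..n. a j ^ m j / fact (m j))) =
    a k * exp_coeff a (n - k)"
proof -
  define w where "w = (\<lambda>m. \<Prod>j=1..n. a j ^ m j / fact (m j))"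
  define dec where "dec = (\<lambda>m::nat \<Rightarrow> nat. m(k := m k - 1))"
  \<comment> \<open>A tuple of weight \<open>n - k\<close> is \<open>undefined\<close> beyond
    \<open>n - k\<close>, so these entries are set to \<open>0\<close> before the part
    \<open>k\<close> is added. This also covers the case \<open>k > n - k\<close>.\<close>
  define ext where "ext = (\<lambda>m::nat \<Rightarrow> nat. \<lambda>j\<in>{1..n}. (if j \<le> n - k then m j else 0) + (if j = k then 1 else 0))"
  define W where "W = {m \<in> weight_tuples n. m k > 0}"
  have split_k: "(\<Sum>j=1..n. f j) = f k + (\<Sum>j\<in>{1..n}-{k}. f j)" for f :: "nat \<Rightarrow> nat"
    using k by (simp add: sum.remove)
  have dec_sum: "(\<Sum>j=1..n. j * dec m j) = n - k" if "m \<in> W" for m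
  proof -
    have "(\<Sum>j=1..n. j * m j) = n" "m k > 0"
      using that by (auto simp: W_def weight_tuples_def)
    moreover have "(\<Sum>j\<in>{1..n}-{k}. j * dec m j) = (\<Sum>j\<in>{1..n}-{k}. j * m j)"
      by (intro sum.cong) (auto simp: dec_def)
    ultimately show ?thesis
      unfolding split_k by (cases "m k") (auto simp: dec_def algebra_simps)
  qed
  \<comment> \<open>The remaining weight is \<open>n - k\<close>, so no larger part can survive;
    restricting to \<open>{1..n-k}\<close> therefore loses nothing.\<close>
  have dec_zero: "dec m j = 0" if "m \<in> W" "j \<in> {1..n}" "j > n - k" for m j
  proof -
    have "j * dec m j \<le> (\<Sum>j=1..n. j * dec m j)"
      by (rule member_le_sum) (use that in auto)
    then have "j * dec m j \<le> n - k" using dec_sum that by simp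
    with \<open>j > n - k\<close> show ?thesis
      by (metis le_trans mult.right_neutral mult_le_mono2 not_less not_less_eq_eq One_nat_def neq0_conv Suc_leI)
  qed
  have "(\<Sum>m\<in>weight_tuples n. real (m k) * w m) = (\<Sum>m\<in>W. real (m k) * w m)"
    by (rule sum.mono_neutral_right) (auto simp: W_def finite_weight_tuples)
  also have "\<dots> = (\<Sum>m\<in>weight_tuples (n - k). a k * (\<Prod>j=1..n-k. a j ^ m j / fact (m j)))"
  proof (rule sum.reindex_bij_witness[of _ ext "\<lambda>m. restrict (dec m) {1..n-k}"])
    fix m assume m: "m \<in> W"
    show "ext (restrict (dec m) {1..n-k}) = m"
    proof
      fix j
      have "m \<in> extensional {1..n}" "m k > 0"
        using m by (auto simp: W_def weight_tuples_def PiE_def)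
      then show "ext (restrict (dec m) {1..n-k}) j = m j"
        using dec_zero[OF m, of j] k by (auto simp: ext_def dec_def extensional_def restrict_def)
    qed
    have "(\<Sum>j=1..n-k. j * dec m j) = (\<Sum>j=1..n. j * dec m j)"
      by (rule sum.mono_neutral_left) (use dec_zero[OF m] in auto)
    then show "restrict (dec m) {1..n-k} \<in> weight_tuples (n - k)"
      using dec_sum[OF m] by (auto simp: weight_tuples_def)
    have "(\<Prod>j=1..n-k. a j ^ dec m j / fact (dec m j)) = (\<Prod>j=1..n. a j ^ dec m j / fact (dec m j))"
      by (rule prod.mono_neutral_left) (use dec_zero[OF m] in auto)
    also have "\<dots> = (a k ^ dec m k / fact (dec m k)) * (\<Prod>j\<in>{1..n}-{k}. a j ^ dec m j / fact (dec m j))"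
      using k by (simp add: prod.remove)
    also have "(\<Prod>j\<in>{1..n}-{k}. a j ^ dec m j / fact (dec m j)) = (\<Prod>j\<in>{1..n}-{k}. a j ^ m j / fact (m j))"
      by (intro prod.cong) (auto simp: dec_def)
    also have "a k * (a k ^ dec m k / fact (dec m k) * (\<Prod>j\<in>{1..n}-{k}. a j ^ m j / fact (m j))) =
        real (m k) * ((a k ^ m k / fact (m k)) * (\<Prod>j\<in>{1..n}-{k}. a j ^ m j / fact (m j)))"
      using m by (cases "m k") (auto simp: dec_def W_def simp del: of_nat_Suc)
    also have "(a k ^ m k / fact (m k)) * (\<Prod>j\<in>{1..n}-{k}. a j ^ m j / fact (m j)) = w m"
      using k by (simp add: w_def prod.remove)
    finally show "a k * (\<Prod>j=1..n-k. a j ^ restrict (dec m) {1..n-k} j / fact (restrict (dec m) {1..n-k} j)) = real (m k) * w m"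
      by simp
  next
    fix m assume m: "m \<in> weight_tuples (n - k)"
    have *: "m \<in> extensional {1..n-k}" "(\<Sum>j=1..n-k. j * m j) = n - k"
      using m by (auto simp: weight_tuples_def PiE_def)
    show "restrict (dec (ext m)) {1..n-k} = m"
      using * k by (fastforce simp: ext_def dec_def restrict_def extensional_def)
    have "(\<Sum>j=1..n. j * ext m j) = (\<Sum>j=1..n. (if j \<le> n - k then j * m j else 0) + (if j = k then j else 0))"
      by (intro sum.cong) (auto simp: ext_def)
    also have "\<dots> = (\<Sum>j=1..n. if j \<le> n - k then j * m j else 0) + k"
      using k by (simp add: sum.distrib)
    also have "(\<Sum>j=1..n. if j \<le> n - k then j * m j else 0) = (\<Sum>j=1..n-k. j * m j)"
      by (rule sum.mono_neutral_cong_right) auto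
    finally show "ext m \<in> W"
      using * k by (auto simp: W_def weight_tuples_def ext_def)
  qed
  finally show ?thesis
    by (simp add: w_def exp_coeff_altdef sum_distrib_left)
qed

text \<open>This is the identity F' = F P' for F = exp P, read off coefficientwise. It is proved by
  counting: replace the factor \<open>n\<close> by the weight of each tuple and exchange the two
  sums.\<close>

lemma exp_coeff_rec:
  "real n * exp_coeff a n = (\<Sum>k=1..n. real k * a k * exp_coeff a (n - k))"
proof -
  define w where "w = (\<lambda>m. \<Prod>j=1..n. a j ^ m j / fact (m j))"
  have "real n * exp_coeff a n = (\<Sum>m\<in>weight_tuples n. real n * w m)"
    by (simp add: exp_coeff_altdef sum_distrib_left w_def)
  also have "\<dots> = (\<Sum>m\<in>weight_tuples n. \<Sum>k=1..n. real k * (real (m k) * w m))"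
  proof (rule sum.cong)
    fix m assume "m \<in> weight_tuples n"
    then have "real n = real (\<Sum>k=1..n. k * m k)"
      by (simp add: weight_tuples_def)
    then show "real n * w m = (\<Sum>k=1..n. real k * (real (m k) * w m))"
      by (simp add: sum_distrib_right mult.assoc)
  qed simp
  also have "\<dots> = (\<Sum>k=1..n. real k * (\<Sum>m\<in>weight_tuples n. real (m k) * w m))"
    by (subst sum.swap) (simp add: sum_distrib_left)
  also have "\<dots> = (\<Sum>k=1..n. real k * (a k * exp_coeff a (n - k)))"
    by (intro sum.cong refl) (simp only: w_def sum_weight_tuples_mult_part)
  finally show ?thesis by (simp add: mult.assoc)
qed

lemma exp_coeff_nonneg: "(\<And>j. j \<ge> 1 \<Longrightarrow> a j \<ge> 0) \<Longrightarrow> exp_coeff a n \<ge> 0"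
  unfolding exp_coeff_altdef by (intro sum_nonneg prod_nonneg) auto

section \<open>The coefficients as integrals\<close>

text \<open>As a formal series, exp P satisfies the recurrence of \<open>exp_coeff_rec\<close> with
  the same initial value, which identifies its coefficients. Since P converges on the unit disc, exp
  P is holomorphic there and equals the sum of its expansion.\<close>

lemma exp_coeff_sums:
  fixes a :: "nat \<Rightarrow> real" and z :: complex
  assumes a0: "a 0 = 0"
    and summ: "\<And>r. 0 < r \<Longrightarrow> r < 1 \<Longrightarrow> summable (\<lambda>k. a k * r ^ k)"
    and z: "norm z < 1"
  shows "(\<lambda>n. of_real (exp_coeff a n) * z ^ n) sums exp (\<Sum>k. of_real (a k) * z ^ k)"
proof -
  define P :: "complex fps" where "P = Abs_fps (\<lambda>k. of_real (a k))"
  define H where "H = fps_exp 1 oo P"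
  have P0: "fps_nth P 0 = 0" by (simp add: P_def a0)
  have radius: "fps_conv_radius P \<ge> 1"
    unfolding fps_conv_radius_def
  proof (rule conv_radius_geI_ex)
    fix r :: real assume "0 < r" "ereal r < 1"
    then have "summable (\<lambda>k. complex_of_real (a k * r ^ k))"
      by (intro summable_of_real summ) auto
    then show "\<exists>z. norm z = r \<and> summable (\<lambda>n. fps_nth P n * z ^ n)"
      using \<open>0 < r\<close> by (intro exI[of _ "of_real r"]) (simp add: P_def)
  qed
  have Pexp: "eval_fps P has_fps_expansion P"
    by (rule eval_fps_has_fps_expansion) (use radius in \<open>auto intro: less_le_trans[of 0 1]\<close>)
  have Hexp: "(exp \<circ> eval_fps P) has_fps_expansion H"
    unfolding H_def by (rule has_fps_expansion_compose[OF has_fps_expansion_exp1 Pexp P0])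
  have "eball (0 :: complex) 1 \<subseteq> eball 0 (fps_conv_radius P)"
  proof
    fix x :: complex assume "x \<in> eball 0 1"
    then have "ereal (norm x) < 1" by simp
    then have "ereal (norm x) < fps_conv_radius P" using radius by (rule order.strict_trans2)
    then show "x \<in> eball 0 (fps_conv_radius P)" by simp
  qed
  then have hol: "(exp \<circ> eval_fps P) holomorphic_on eball 0 1"
    unfolding o_def by (intro holomorphic_intros) auto
  have Hderiv: "fps_deriv H = H * fps_deriv P"
    unfolding H_def by (simp add: fps_compose_deriv P0)
  have nth: "fps_nth H n = of_real (exp_coeff a n)" for n
  proof (induction n rule: less_induct)
    case (less n)
    show ?case
    proof (cases n)
      case 0
      then show ?thesis by (simp add: H_def exp_coeff_0)
    next
      case (Suc m)
      have "of_nat n * fps_nth H n = fps_nth (fps_deriv H) m"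
        by (simp add: Suc)
      also have "\<dots> = (\<Sum>i=0..m. fps_nth (fps_deriv P) i * fps_nth H (m - i))"
        unfolding Hderiv by (subst mult.commute) (simp add: fps_mult_nth)
      also have "\<dots> = (\<Sum>i=0..m. of_real (real (Suc i) * a (Suc i) * exp_coeff a (n - Suc i)))"
        by (intro sum.cong refl) (simp add: Suc less.IH P_def)
      also have "\<dots> = of_real (\<Sum>k=1..n. real k * a k * exp_coeff a (n - k))"
        unfolding Suc of_real_sum One_nat_def by (subst sum.shift_bounds_cl_Suc_ivl) simp
      also have "\<dots> = of_nat n * of_real (exp_coeff a n)"
        by (subst exp_coeff_rec[symmetric]) simp
      finally show ?thesis using Suc by (simp del: of_nat_Suc)
    qed
  qed
  have "(\<lambda>n. fps_nth H n * z ^ n) sums (exp \<circ> eval_fps P) z"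
    by (rule has_fps_expansion_imp_sums_complex[OF Hexp hol]) (use z in simp)
  then show ?thesis
    by (simp add: nth eval_fps_def P_def)
qed

lemma has_integral_cos_int:
  "((\<lambda>\<theta>. cos (of_int j * \<theta>)) has_integral (if j = 0 then pi else 0)) {0..pi}"
proof (cases "j = 0")
  case True
  then show ?thesis using has_integral_const_real[of "1::real" 0 pi] by simp
next
  case False
  have "((\<lambda>\<theta>. cos (of_int j * \<theta>)) has_integral (sin (of_int j * pi) / of_int j - sin (of_int j * 0) / of_int j)) {0..pi}"
    by (rule fundamental_theorem_of_calculus)
      (auto intro!: derivative_eq_intros simp: False simp flip: has_real_derivative_iff_has_vector_derivative)
  then show ?thesis using False by (simp add: mult.commute)
qed

text \<open>Cauchy's formula on the circle of radius \<open>r\<close>: expand into a cosine series,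
  integrate term by term, and only the index \<open>n\<close> survives. Real coefficients make the
  real part even in \<theta>, so half of the circle is enough.\<close>

lemma exp_coeff_has_integral:
  fixes a :: "nat \<Rightarrow> real"
  assumes a0: "a 0 = 0" and nonneg: "\<And>k. a k \<ge> 0"
    and summ: "\<And>r. 0 < r \<Longrightarrow> r < 1 \<Longrightarrow> summable (\<lambda>k. a k * r ^ k)"
    and r: "0 < r" "r < 1"
  shows "((\<lambda>\<theta>. exp (\<Sum>k. a k * r ^ k * cos (real k * \<theta>)) *
             cos ((\<Sum>k. a k * r ^ k * sin (real k * \<theta>)) - real n * \<theta>))
          has_integral (pi * (exp_coeff a n * r ^ n))) {0..pi}"
    (is "(?f has_integral _) _")
proof -
  define c where "c = exp_coeff a"
  define g where "g = (\<lambda>\<theta>. \<Sum>k. of_real (a k) * (of_real r * cis \<theta>) ^ k)"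
  have c_sums: "(\<lambda>m. of_real (c m) * (of_real r * cis \<theta>) ^ m) sums exp (g \<theta>)" for \<theta>
    unfolding c_def g_def
    by (rule exp_coeff_sums[OF a0 summ]) (use r in \<open>auto simp: norm_mult\<close>)
  have g_summ: "summable (\<lambda>k. of_real (a k) * (of_real r * cis \<theta>) ^ k)" for \<theta>
    by (rule summable_norm_cancel) (use r summ nonneg in \<open>simp add: norm_mult norm_power\<close>)
  have Re_g: "Re (g \<theta>) = (\<Sum>k. a k * r ^ k * cos (real k * \<theta>))"
    and Im_g: "Im (g \<theta>) = (\<Sum>k. a k * r ^ k * sin (real k * \<theta>))" for \<theta>
    unfolding g_def by (subst Re_suminf[OF g_summ] Im_suminf[OF g_summ];
        simp add: power_mult_distrib Complex.DeMoivre flip: of_real_power of_real_mult mult.assoc)+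
  have f_eq: "?f \<theta> = Re (exp (g \<theta>) * cis (- real n * \<theta>))" for \<theta>
    by (simp add: exp_eq_polar Re_g Im_g cos_diff algebra_simps)
  have f_sums: "(\<lambda>m. c m * r ^ m * cos (of_int (int m - int n) * \<theta>)) sums ?f \<theta>" for \<theta>
  proof -
    have "(\<lambda>m. Re (of_real (c m) * (of_real r * cis \<theta>) ^ m * cis (- real n * \<theta>))) sums ?f \<theta>"
      unfolding f_eq by (intro sums_Re sums_mult2 c_sums)
    also have "(\<lambda>m. Re (of_real (c m) * (of_real r * cis \<theta>) ^ m * cis (- real n * \<theta>))) =
        (\<lambda>m. c m * r ^ m * cos (of_int (int m - int n) * \<theta>))"
      by (simp add: power_mult_distrib Complex.DeMoivre cis_mult mult.assoc algebra_simps flip: of_real_power)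
    finally show ?thesis .
  qed
  have c_nonneg: "c m \<ge> 0" for m unfolding c_def by (rule exp_coeff_nonneg) (rule nonneg)
  \<comment> \<open>The expansion at angle \<open>0\<close> shows that the nonnegative terms
    \<open>c m * r ^ m\<close> are summable; they are the majorants in the M-test.\<close>
  have "summable (\<lambda>m. c m * r ^ m)"
    using sums_summable[OF sums_Re[OF c_sums[of 0]]]
    by (simp flip: of_real_power of_real_mult)
  then have unif: "uniform_limit {0..pi} (\<lambda>N \<theta>. \<Sum>m<N. c m * r ^ m * cos (of_int (int m - int n) * \<theta>))
      (\<lambda>\<theta>. \<Sum>m. c m * r ^ m * cos (of_int (int m - int n) * \<theta>)) sequentially"
    by (intro Weierstrass_m_test[where M="\<lambda>m. c m * r ^ m"])
      (use r c_nonneg in \<open>auto simp: abs_mult intro!: mult_left_le\<close>)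
  have "(\<lambda>\<theta>. \<Sum>m. c m * r ^ m * cos (of_int (int m - int n) * \<theta>)) = ?f"
    using f_sums by (auto simp: sums_iff)
  note unif = unif[unfolded this]
  obtain I J where I: "\<And>N. ((\<lambda>\<theta>. \<Sum>m<N. c m * r ^ m * cos (of_int (int m - int n) * \<theta>)) has_integral I N) {0..pi}"
    and J: "(?f has_integral J) {0..pi}" and IJ: "I \<longlonglongrightarrow> J"
    by (rule uniform_limit_integral[OF unif]) (auto intro!: continuous_intros)
  have "I N = c n * r ^ n * pi" if "N > n" for N
  proof -
    have "((\<lambda>\<theta>. \<Sum>m<N. c m * r ^ m * cos (of_int (int m - int n) * \<theta>)) has_integral
       (\<Sum>m<N. c m * r ^ m * (if int m - int n = 0 then pi else 0))) {0..pi}"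
      by (intro has_integral_sum has_integral_mult_right has_integral_cos_int) auto
    then have "I N = (\<Sum>m<N. c m * r ^ m * (if int m - int n = 0 then pi else 0))"
      using I by (rule has_integral_unique[rotated])
    also have "\<dots> = (\<Sum>m<N. if m = n then c n * r ^ n * pi else 0)"
      by (intro sum.cong) auto
    also have "\<dots> = c n * r ^ n * pi"
      using that by simp
    finally show ?thesis .
  qed
  then have "I \<longlonglongrightarrow> c n * r ^ n * pi"
    by (intro tendsto_eventually) (auto simp: eventually_at_top_dense)
  then have "J = c n * r ^ n * pi"
    using IJ LIMSEQ_unique by blast
  with J show ?thesis by (simp add: c_def mult_ac)
qed

section \<open>Moments and damping\<close>

text \<open>Apply \<open>ln y \<le> y - 1\<close> to \<open>y = x / (2 * s)\<close>. Spending only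
  half of the exponent leaves the other half to make a geometric series converge.\<close>

lemma powr_le_exp_half:
  fixes x s :: real
  assumes "x \<ge> 0" "s > 0"
  shows "x powr s \<le> (2 * s) powr s * exp (x / 2)"
proof (cases "x = 0")
  case False
  then have x: "x > 0" using assms by simp
  have "ln (x / (2 * s)) \<le> x / (2 * s)"
    by (rule order_trans[OF ln_le_minus_one]) (use x assms in auto)
  then have "s * ln x \<le> s * ln (2 * s) + x / 2"
    using x assms by (simp add: ln_div field_simps)
  then have "exp (s * ln x) \<le> exp (s * ln (2 * s) + x / 2)" by simp
  then show ?thesis using x assms by (simp add: powr_def exp_add)
qed auto

lemma inverse_one_minus_exp_neg_le:
  fixes x :: real
  assumes "0 < x" "x \<le> 1"
  shows "1 / (1 - exp (- x)) \<le> 2 / x"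
proof -
  have "1 + x \<le> exp x" by (rule exp_ge_add_one_self)
  then have "exp (- x) \<le> 1 / (1 + x)"
    using assms by (simp add: exp_minus inverse_eq_divide frac_le)
  also have "\<dots> \<le> 1 - x / 2"
    using assms by (simp add: field_simps power2_eq_square)
  finally have "x / 2 \<le> 1 - exp (- x)" by simp
  then show ?thesis using assms by (simp add: field_simps)
qed

text \<open>Half of the exponential absorbs the power at the cost of \<sigma> powr (-s); the other
  half is a geometric series with sum at most 4/\<sigma>.\<close>

lemma suminf_powr_exp_bound:
  fixes s \<sigma> :: real
  assumes s: "s > 0" and \<sigma>: "0 < \<sigma>" "\<sigma> \<le> 1"
  shows "summable (\<lambda>k. real k powr s * exp (- \<sigma> * real k))"
    and "(\<Sum>k. real k powr s * exp (- \<sigma> * real k)) \<le> 4 * (2 * s) powr s * \<sigma> powr (- s - 1)"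
proof -
  define A where "A = (2 * s) powr s * \<sigma> powr (- s)"
  have le: "real k powr s * exp (- \<sigma> * real k) \<le> A * exp (- (\<sigma> / 2)) ^ k" for k
  proof -
    have "(\<sigma> * real k) powr s * exp (- \<sigma> * real k) \<le>
      ((2 * s) powr s * exp (\<sigma> * real k / 2)) * exp (- \<sigma> * real k)"
      by (intro mult_right_mono powr_le_exp_half) (use assms in auto)
    also have "\<dots> = (2 * s) powr s * exp (- (\<sigma> / 2)) ^ k"
      by (simp add: mult.assoc flip: exp_add exp_of_nat_mult)
    finally show ?thesis
      using \<sigma> by (simp add: A_def powr_mult powr_minus field_simps)
  qed
  have lt1: "exp (- (\<sigma> / 2)) < 1" using \<sigma> by simp
  have gs: "summable (\<lambda>k. A * exp (- (\<sigma> / 2)) ^ k)"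
    using lt1 by (intro summable_mult summable_geometric) auto
  show summ: "summable (\<lambda>k. real k powr s * exp (- \<sigma> * real k))"
    by (rule summable_comparison_test'[OF gs, of 0]) (use le in auto)
  have "(\<Sum>k. real k powr s * exp (- \<sigma> * real k)) \<le> (\<Sum>k. A * exp (- (\<sigma> / 2)) ^ k)"
    by (rule suminf_le[OF le summ gs])
  also have "\<dots> = A * (1 / (1 - exp (- (\<sigma> / 2))))"
    using lt1 by (subst suminf_mult) (auto simp: suminf_geometric)
  also have "\<dots> \<le> A * (2 / (\<sigma> / 2))"
    by (intro mult_left_mono inverse_one_minus_exp_neg_le) (use \<sigma> in \<open>auto simp: A_def\<close>)
  also have "\<dots> = 4 * (2 * s) powr s * \<sigma> powr (- s - 1)"
    using \<sigma> by (simp add: A_def powr_diff)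
  finally show "(\<Sum>k. real k powr s * exp (- \<sigma> * real k)) \<le> 4 * (2 * s) powr s * \<sigma> powr (- s - 1)" .
qed

text \<open>The upper bound on \<open>a\<close> turns the \<open>q\<close>-th moment into the
  previous sum with exponent \<open>s\<close>. The condition \<open>q \<ge> 1\<close> gives
  \<open>s > 0\<close> and kills the term \<open>k = 0\<close>, for which no bound on
  \<open>a\<close> is assumed.\<close>

lemma moment_bound:
  fixes a :: "nat \<Rightarrow> real"
  assumes p: "p > 0" and \<sigma>: "0 < \<sigma>" "\<sigma> \<le> 1" and q: "q \<ge> 1"
    and nonneg: "\<And>k. a k \<ge> 0"
    and upper: "\<And>k. k \<ge> 1 \<Longrightarrow> a k \<le> \<gamma> * real k powr (p - 1)"
  defines "s \<equiv> p + real q - 1"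
  shows "summable (\<lambda>k. real k ^ q * (a k * exp (- \<sigma> * real k)))"
    and "(\<Sum>k. real k ^ q * (a k * exp (- \<sigma> * real k)))
        \<le> \<gamma> * (4 * (2 * s) powr s) * \<sigma> powr (- p - real q)"
proof -
  have s: "s > 0" using p q by (simp add: s_def)
  have "\<gamma> \<ge> 0" using upper[of 1] nonneg[of 1] by simp
  have le: "real k ^ q * (a k * exp (- \<sigma> * real k)) \<le> \<gamma> * (real k powr s * exp (- \<sigma> * real k))" for k
  proof (cases "k = 0")
    case False
    have "real k ^ q * a k \<le> real k ^ q * (\<gamma> * real k powr (p - 1))"
      using False by (intro mult_left_mono upper) auto
    also have "\<dots> = \<gamma> * real k powr s"
      using False by (simp add: s_def powr_diff powr_add powr_realpow field_simps)
    finally show ?thesis by (simp flip: mult.assoc)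
  qed (use q in \<open>simp add: power_0_left\<close>)
  note summ' = summable_mult[OF suminf_powr_exp_bound(1)[OF s \<sigma>], of \<gamma>]
  show summ: "summable (\<lambda>k. real k ^ q * (a k * exp (- \<sigma> * real k)))"
    by (rule summable_comparison_test'[OF summ', of 0]) (use le nonneg in auto)
  have "(\<Sum>k. real k ^ q * (a k * exp (- \<sigma> * real k))) \<le> (\<Sum>k. \<gamma> * (real k powr s * exp (- \<sigma> * real k)))"
    by (rule suminf_le[OF le summ summ'])
  also have "\<dots> = \<gamma> * (\<Sum>k. real k powr s * exp (- \<sigma> * real k))"
    by (rule suminf_mult[OF suminf_powr_exp_bound(1)[OF s \<sigma>]])
  also have "\<dots> \<le> \<gamma> * (4 * (2 * s) powr s * \<sigma> powr (- s - 1))"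
    by (intro mult_left_mono suminf_powr_exp_bound s \<sigma> \<open>\<gamma> \<ge> 0\<close>)
  also have "- s - 1 = - p - real q" by (simp add: s_def)
  finally show "(\<Sum>k. real k ^ q * (a k * exp (- \<sigma> * real k)))
        \<le> \<gamma> * (4 * (2 * s) powr s) * \<sigma> powr (- p - real q)" by simp
qed

section \<open>Trigonometric inequalities and the lower bound for the damping sum\<close>

lemma abs_sin_diff_self_le: "\<bar>sin x - x\<bar> \<le> \<bar>x\<bar> ^ 3 / 6" for x :: real
proof -
  have "\<bar>sin x - (\<Sum>m<3. sin_coeff m * x ^ m)\<bar> \<le> inverse (fact 3) * \<bar>x\<bar> ^ 3"
    by (rule Maclaurin_sin_bound)
  moreover have "(\<Sum>m<3. sin_coeff m * x ^ m) = x"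
    by (simp add: sin_coeff_def numeral_eq_Suc)
  ultimately show ?thesis by (simp add: fact_numeral)
qed

text \<open>Both bounds come from 1 - cos x = 2 sin(x/2)^2. For the lower one on [0, 1], the cubic
  estimate gives sin z >= 3z/4 at z = x/2; beyond 1, cosine is decreasing up to pi.\<close>

lemma one_minus_cos_bounds:
  fixes x :: real
  shows one_minus_cos_le: "1 - cos x \<le> x\<^sup>2 / 2"
    and one_minus_cos_ge: "0 \<le> x \<Longrightarrow> x \<le> pi \<Longrightarrow> 1 - cos x \<ge> min 1 (x\<^sup>2) / 4"
proof -
  have "\<bar>sin (x / 2)\<bar> \<le> \<bar>x / 2\<bar>" by (rule abs_sin_x_le_abs_x)
  then have "(sin (x / 2))\<^sup>2 \<le> (x / 2)\<^sup>2" by (simp only: abs_le_square_iff)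
  then show "1 - cos x \<le> x\<^sup>2 / 2"
    using cos_double_sin[of "x / 2"] by (simp add: power2_eq_square)
next
  have small: "1 - cos y \<ge> y\<^sup>2 / 4" if "0 \<le> y" "y \<le> 1" for y :: real
  proof -
    define z where "z = y / 2"
    have z: "0 \<le> z" "z \<le> 1 / 2" using that by (auto simp: z_def)
    have "\<bar>sin z - z\<bar> \<le> z ^ 3 / 6"
      using abs_sin_diff_self_le[of z] z by simp
    then have "sin z \<ge> z - z ^ 3 / 6" by linarith
    moreover have "z ^ 3 \<le> z"
      using z power_decreasing[of 1 3 z] by simp
    ultimately have "sin z \<ge> 3 / 4 * z" using z by linarith
    then have "(3 / 4 * z)\<^sup>2 \<le> (sin z)\<^sup>2" using z by (intro power_mono) auto
    moreover have "cos y = 1 - 2 * (sin z)\<^sup>2"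
      using cos_double_sin[of z] by (simp add: z_def)
    ultimately have "1 - cos y \<ge> 2 * (3 / 4 * z)\<^sup>2" by simp
    moreover have "2 * (3 / 4 * z)\<^sup>2 \<ge> y\<^sup>2 / 4"
      by (simp add: z_def power2_eq_square)
    ultimately show ?thesis by linarith
  qed
  assume x: "0 \<le> x" "x \<le> pi"
  show "1 - cos x \<ge> min 1 (x\<^sup>2) / 4"
  proof (cases "x \<le> 1")
    case True
    then show ?thesis using small[of x] x by linarith
  next
    case False
    then have "cos x \<le> cos 1" using x by (intro cos_monotone_0_pi_le) auto
    then show ?thesis using small[of 1] by simp
  qed
qed

text \<open>At half angles this is |sin(v - u)| <= |sin v| + |sin u|, squared by means of (s + t)^2
  <= 2 s^2 + 2 t^2.\<close>

lemma one_minus_cos_shift: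
  fixes x y :: real
  shows "(1 - cos x) + (1 - cos (x + y)) \<ge> (1 - cos y) / 2"
proof -
  define u v where "u = x / 2" and "v = (x + y) / 2"
  have halves: "2 * u = x" "2 * v = x + y" "2 * (v - u) = y"
    by (simp_all add: u_def v_def field_simps)
  have "sin (v - u) = sin v * cos u - cos v * sin u" by (simp add: sin_diff)
  then have "\<bar>sin (v - u)\<bar> \<le> \<bar>sin v\<bar> * \<bar>cos u\<bar> + \<bar>cos v\<bar> * \<bar>sin u\<bar>"
    by (metis abs_triangle_ineq4 abs_mult)
  also have "\<dots> \<le> \<bar>sin v\<bar> + \<bar>sin u\<bar>"
    by (intro add_mono mult_left_le mult_left_le_one_le) auto
  finally have "\<bar>sin (v - u)\<bar>\<^sup>2 \<le> (\<bar>sin v\<bar> + \<bar>sin u\<bar>)\<^sup>2"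
    by (intro power_mono) auto
  also have "\<dots> \<le> 2 * (sin v)\<^sup>2 + 2 * (sin u)\<^sup>2"
    using sum_squares_bound[of "\<bar>sin v\<bar>" "\<bar>sin u\<bar>"] by (simp add: power2_sum)
  finally have "(sin (v - u))\<^sup>2 \<le> 2 * (sin v)\<^sup>2 + 2 * (sin u)\<^sup>2" by simp
  moreover have "cos x = 1 - 2 * (sin u)\<^sup>2" "cos (x + y) = 1 - 2 * (sin v)\<^sup>2"
      "cos y = 1 - 2 * (sin (v - u))\<^sup>2"
    using cos_double_sin[of u] cos_double_sin[of v] cos_double_sin[of "v - u"] halves by simp_all
  ultimately show ?thesis by simp
qed

text \<open>
  The terms \<open>k\<close> and \<open>k + j\<close> cannot both be small, so pairing them gives a lower bound that no
  resonance \<open>k \<theta> \<approx> 0\<close> modulo \<open>2 \<pi>\<close> can spoil.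
\<close>
lemma sum_one_minus_cos_ge:
  fixes \<theta> :: real
  assumes "j \<le> M"
  shows "(\<Sum>k\<in>{M<..3*M}. 1 - cos (real k * \<theta>)) \<ge> real M * (1 - cos (real j * \<theta>)) / 4"
proof -
  define S where "S = (\<Sum>k\<in>{M<..3*M}. 1 - cos (real k * \<theta>))"
  have "real M * ((1 - cos (real j * \<theta>)) / 2) = (\<Sum>k\<in>{M<..2*M}. (1 - cos (real j * \<theta>)) / 2)"
    by simp
  also have "\<dots> \<le> (\<Sum>k\<in>{M<..2*M}. (1 - cos (real k * \<theta>)) + (1 - cos (real k * \<theta> + real j * \<theta>)))"
    by (intro sum_mono one_minus_cos_shift)
  also have "\<dots> = (\<Sum>k\<in>{M<..2*M}. 1 - cos (real k * \<theta>)) + (\<Sum>k\<in>{M<..2*M}. 1 - cos (real (k + j) * \<theta>))"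
    by (simp only: sum.distrib of_nat_add distrib_right)
  also have "(\<Sum>k\<in>{M<..2*M}. 1 - cos (real (k + j) * \<theta>)) = (\<Sum>k\<in>(\<lambda>k. k + j) ` {M<..2*M}. 1 - cos (real k * \<theta>))"
    by (subst sum.reindex) auto
  \<comment> \<open>A shift by \<open>j \<le> M\<close> keeps \<open>{M<..2*M}\<close> inside
    \<open>{M<..3*M}\<close>. Both halves are thus at most \<open>S\<close>, which accounts for the
    second factor 2 in the constant 4.\<close>
  also have "\<dots> \<le> S"
    unfolding S_def by (intro sum_mono2) (use assms in auto)
  also have "(\<Sum>k\<in>{M<..2*M}. 1 - cos (real k * \<theta>)) \<le> S"
    unfolding S_def by (intro sum_mono2) auto
  finally show ?thesis by (simp add: S_def)
qed

lemma exists_multiple_one_minus_cos_ge: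
  fixes \<theta> :: real
  assumes \<theta>: "0 \<le> \<theta>" "\<theta> \<le> pi" and M: "M \<ge> 1"
  shows "\<exists>j\<le>M. 1 - cos (real j * \<theta>) \<ge> min 1 ((real M * \<theta>)\<^sup>2) / 4"
proof (cases "real M * \<theta> \<le> pi")
  case True
  then show ?thesis using \<theta> by (intro exI[of _ M] conjI one_minus_cos_ge) auto
next
  case False
  then have big: "real M * \<theta> > pi" by simp
  then have pos: "\<theta> > 0" using \<theta> by (cases "\<theta> = 0") auto
  \<comment> \<open>The first multiple of \<theta> that reaches pi/2. As \<theta> is at most pi, it
    does not pass 3 pi/2, so its cosine is not positive.\<close>
  define j where "j = nat \<lceil>pi / (2 * \<theta>)\<rceil>"
  have j: "pi / (2 * \<theta>) \<le> real j" "real j < pi / (2 * \<theta>) + 1"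
    using pos by (auto simp: j_def) linarith
  have lo: "pi / 2 \<le> real j * \<theta>" using j(1) pos by (simp add: field_simps)
  have hi: "real j * \<theta> < pi / 2 + \<theta>" using j(2) pos by (simp add: field_simps)
  have "M \<ge> 2" 
  proof (rule ccontr)
    assume "\<not> M \<ge> 2"
    then have "M = 1" using M by simp
    then show False using big \<theta> by simp
  qed
  have "pi / (2 * \<theta>) < real M / 2" using big pos by (simp add: field_simps)
  then have "real j < real M / 2 + 1" using j by linarith
  also have "\<dots> \<le> real M" using \<open>M \<ge> 2\<close> by simp
  finally have "j \<le> M" by simp
  have "cos (real j * \<theta> - pi) \<ge> 0"
    using lo hi \<theta> by (intro cos_ge_zero) auto
  then have "cos (real j * \<theta>) \<le> 0" by simp
  then have "min 1 ((real M * \<theta>)\<^sup>2) / 4 \<le> 1 - cos (real j * \<theta>)"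
    by linarith
  with \<open>j \<le> M\<close> show ?thesis by blast
qed

text \<open>Only the block \<open>{M<..3*M}\<close> with M about 1/\<sigma> is kept. There the
  exponential is at least exp(-6), because k <= 3 M <= 6/\<sigma>, and the pairing bound for the
  cosines applies. The constant 48 is 3 * 4 * 4: from the coefficients, from the pairing, and from
  the best multiple \<open>j\<close>.\<close>

lemma damping_lower_bound:
  fixes a :: "nat \<Rightarrow> real"
  assumes p: "p > 0" and \<sigma>: "0 < \<sigma>" "\<sigma> \<le> 1" and \<theta>: "0 \<le> \<theta>" "\<theta> \<le> pi"
    and nonneg: "\<And>k. a k \<ge> 0" and \<gamma>: "\<gamma> \<ge> 0"
    and lower: "\<And>k. real k \<ge> 1 / \<sigma> \<Longrightarrow> \<gamma> * real k powr (p - 1) \<le> a k"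
    and summ: "summable (\<lambda>k. a k * exp (- \<sigma> * real k))"
  shows "(\<Sum>k. a k * exp (- \<sigma> * real k) * (1 - cos (real k * \<theta>))) \<ge>
    \<gamma> * exp (- 6) / 48 * \<sigma> powr (- p) * min 1 ((\<theta> / \<sigma>)\<^sup>2)"
proof -
  define M where "M = nat \<lceil>1 / \<sigma>\<rceil>"
  have M: "1 / \<sigma> \<le> real M" "real M < 1 / \<sigma> + 1"
    using \<sigma> by (auto simp: M_def) linarith
  have "1 \<le> 1 / \<sigma>" using \<sigma> by simp
  then have M1: "M \<ge> 1" "real M \<le> 2 / \<sigma>" using M by (linarith, simp)
  \<comment> \<open>Writing k powr (p - 1) as (k powr p) / k and bounding numerator and denominator
    separately avoids a distinction by the sign of p - 1.\<close>
  define c where "c = \<gamma> * (real M powr p / (3 * real M)) * exp (- 6)"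
  have "c \<ge> 0" using \<gamma> by (simp add: c_def)
  have coeff: "a k * exp (- \<sigma> * real k) \<ge> c" if k: "k \<in> {M<..3*M}" for k
  proof -
    have kr: "real M < real k" "real k \<le> 3 * real M" using k by auto
    have "real M powr p / (3 * real M) \<le> real k powr p / real k"
      using kr M1 p by (intro frac_le powr_mono2) auto
    also have "\<dots> = real k powr (p - 1)" using kr by (simp add: powr_diff)
    finally have "\<gamma> * (real M powr p / (3 * real M)) \<le> \<gamma> * real k powr (p - 1)"
      using \<gamma> by (rule mult_left_mono)
    also have "\<dots> \<le> a k" using kr M by (intro lower) auto
    finally have 1: "\<gamma> * (real M powr p / (3 * real M)) \<le> a k" .
    have "real k \<le> 6 / \<sigma>" using kr M1 by simp
    then have "\<sigma> * real k \<le> 6" using \<sigma> by (simp add: field_simps)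
    then have 2: "exp (- 6) \<le> exp (- \<sigma> * real k)" by simp
    show ?thesis unfolding c_def
      by (intro mult_mono 1 2) (use nonneg in auto)
  qed
  obtain j where j: "j \<le> M" "1 - cos (real j * \<theta>) \<ge> min 1 ((real M * \<theta>)\<^sup>2) / 4"
    using exists_multiple_one_minus_cos_ge[OF \<theta> M1(1)] by blast
  have "(\<theta> / \<sigma>)\<^sup>2 \<le> (real M * \<theta>)\<^sup>2"
    using mult_right_mono[OF M(1) \<theta>(1)] \<theta> \<sigma> by (intro power_mono) auto
  then have min: "min 1 ((\<theta> / \<sigma>)\<^sup>2) \<le> min 1 ((real M * \<theta>)\<^sup>2)" by auto
  have "\<sigma> powr (- p) = (1 / \<sigma>) powr p" using \<sigma> by (simp add: powr_minus powr_divide field_simps)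
  also have "\<dots> \<le> real M powr p" using M \<sigma> p by (intro powr_mono2) auto
  finally have "\<gamma> * exp (- 6) / 48 * \<sigma> powr (- p) * min 1 ((\<theta> / \<sigma>)\<^sup>2) \<le>
    \<gamma> * exp (- 6) / 48 * real M powr p * min 1 ((real M * \<theta>)\<^sup>2)"
    using min \<gamma> by (intro mult_mono) auto
  also have "\<dots> = c * (real M * (min 1 ((real M * \<theta>)\<^sup>2) / 4) / 4)"
    using M1 by (simp add: c_def)
  also have "\<dots> \<le> c * (real M * (1 - cos (real j * \<theta>)) / 4)"
    using j \<open>c \<ge> 0\<close> by (intro mult_left_mono divide_right_mono) auto
  also have "\<dots> \<le> c * (\<Sum>k\<in>{M<..3*M}. 1 - cos (real k * \<theta>))"
    using \<open>c \<ge> 0\<close> by (intro mult_left_mono sum_one_minus_cos_ge j)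
  also have "\<dots> \<le> (\<Sum>k\<in>{M<..3*M}. a k * exp (- \<sigma> * real k) * (1 - cos (real k * \<theta>)))"
    unfolding sum_distrib_left by (intro sum_mono mult_right_mono coeff) auto
  also have "\<dots> \<le> (\<Sum>k. a k * exp (- \<sigma> * real k) * (1 - cos (real k * \<theta>)))"
  proof (rule sum_le_suminf)
    have "\<bar>1 - cos (real k * \<theta>)\<bar> \<le> 2" for k
      using cos_ge_minus_one[of "real k * \<theta>"] cos_le_one[of "real k * \<theta>"] by linarith
    then show "summable (\<lambda>k. a k * exp (- \<sigma> * real k) * (1 - cos (real k * \<theta>)))"
      by (intro summable_comparison_test'[OF summable_mult[OF summ, of 2], of 0])
         (auto simp: abs_mult nonneg mult_ac intro!: mult_left_mono)
  qed (use nonneg in auto)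
  finally show ?thesis .
qed

section \<open>The saddle point estimates\<close>

lemma has_integral_step:
  fixes b c w :: real
  assumes "0 \<le> b" "b \<le> w"
  shows "((\<lambda>x. if x \<in> {0..b} then c else 0) has_integral c * b) {0..w}"
  using assms has_integral_const_real[of c 0 b]
  by (subst has_integral_restrict) (auto simp: mult.commute)

text \<open>Here \<open>u k\<close> plays the role of the term \<open>a k * r ^ k\<close>, and the
  factor \<open>exp (- suminf u)\<close> is the division by F(r). The integrals are compared with
  step functions, so that the limit argument later needs only powers of \<sigma>.\<close>

lemma saddle_point_estimates:
  fixes u :: "nat \<Rightarrow> real" and I :: "nat \<Rightarrow> real"
  assumes nonneg: "\<And>k. u k \<ge> 0" and u0: "u 0 = 0"
    and summ: "summable (\<lambda>k. real k ^ 3 * u k)"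
    and mean: "(\<Sum>k. real k * u k) = real n"
    and int: "\<And>m. ((\<lambda>\<theta>. exp (\<Sum>k. u k * cos (real k * \<theta>)) *
             cos ((\<Sum>k. u k * sin (real k * \<theta>)) - real m * \<theta>)) has_integral I m) {0..pi}"
    and \<beta>: "0 < \<beta>" "\<beta> \<le> \<tau>" "\<tau> \<le> pi"
    and second: "(\<Sum>k. real k ^ 2 * u k) * \<beta> ^ 2 \<le> 2 * H"
    and third: "(\<Sum>k. real k ^ 3 * u k) * \<tau> ^ 3 \<le> 6"
    and tail: "\<And>\<theta>. \<tau> \<le> \<theta> \<Longrightarrow> \<theta> \<le> pi \<Longrightarrow> T \<le> (\<Sum>k. u k * (1 - cos (real k * \<theta>)))"
  shows "exp (- suminf u) * I n \<ge> \<beta> * (exp (- H) / 2) - pi * exp (- T)"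
    and "\<bar>exp (- suminf u) * I (n + 1) - exp (- suminf u) * I n\<bar> \<le> \<tau>\<^sup>2 + pi\<^sup>2 * exp (- T)"
proof -
  \<comment> \<open>For \<open>q = 0\<close> and \<open>k = 0\<close> the left side is
    \<open>u 0\<close>, since \<open>0 ^ 0 = 1\<close>; this is where \<open>u 0 = 0\<close>
    enters.\<close>
  have le3: "real k ^ q * u k \<le> real k ^ 3 * u k" if "q \<le> 3" for k q
    using that nonneg u0 by (cases "k = 0") (auto intro!: mult_right_mono power_increasing)
  have summq: "summable (\<lambda>k. real k ^ q * u k)" if "q \<le> 3" for q
    by (rule summable_comparison_test'[OF summ, of 0]) (use le3[OF that] nonneg in auto)
  have summ0: "summable u" using summq[of 0] by simp
  have summ1: "summable (\<lambda>k. real k * u k)" using summq[of 1] by simp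
  have summ2: "summable (\<lambda>k. real k ^ 2 * u k)" using summq[of 2] by simp
  have summ_bdd: "summable (\<lambda>k. u k * f k)" if "\<And>k. \<bar>f k\<bar> \<le> 1" for f
    by (rule summable_comparison_test'[OF summ0, of 0])
      (use that nonneg in \<open>auto simp: abs_mult intro!: mult_left_le\<close>)
  have summ_cos: "summable (\<lambda>k. u k * cos (real k * \<theta>))"
    and summ_sin: "summable (\<lambda>k. u k * sin (real k * \<theta>))" for \<theta>
    by (rule summ_bdd; simp)+

  define D where "D = (\<lambda>\<theta>. \<Sum>k. u k * (1 - cos (real k * \<theta>)))"
  define S where "S = (\<lambda>\<theta>. \<Sum>k. u k * sin (real k * \<theta>))"
  define f where "f = (\<lambda>m \<theta>. exp (- D \<theta>) * cos (S \<theta> - real m * \<theta>))"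
  define E where "E = exp (- T)"
  have D_eq: "D \<theta> = suminf u - (\<Sum>k. u k * cos (real k * \<theta>))" for \<theta>
    unfolding D_def right_diff_distrib mult_1_right by (intro suminf_diff[symmetric] summ0 summ_cos)
  have D_summ: "summable (\<lambda>k. u k * (1 - cos (real k * \<theta>)))" for \<theta>
    unfolding right_diff_distrib mult_1_right by (intro summable_diff summ0 summ_cos)
  have D_nonneg: "D \<theta> \<ge> 0" for \<theta>
    unfolding D_def by (intro suminf_nonneg D_summ) (simp add: nonneg)
  have D_le: "D \<theta> \<le> \<theta>\<^sup>2 / 2 * (\<Sum>k. real k ^ 2 * u k)" for \<theta>
  proof -
    have "D \<theta> \<le> (\<Sum>k. \<theta>\<^sup>2 / 2 * (real k ^ 2 * u k))"
      unfolding D_def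
    proof (rule suminf_le[OF _ D_summ summable_mult[OF summ2]])
      fix k
      have "u k * (1 - cos (real k * \<theta>)) \<le> u k * ((real k * \<theta>)\<^sup>2 / 2)"
        by (intro mult_left_mono one_minus_cos_le nonneg)
      then show "u k * (1 - cos (real k * \<theta>)) \<le> \<theta>\<^sup>2 / 2 * (real k ^ 2 * u k)"
        by (simp add: power_mult_distrib mult_ac)
    qed
    then show ?thesis by (simp only: suminf_mult[OF summ2])
  qed
  have phase: "\<bar>S \<theta> - real n * \<theta>\<bar> \<le> \<theta> ^ 3 / 6 * (\<Sum>k. real k ^ 3 * u k)" if "\<theta> \<ge> 0" for \<theta>
  proof -
    \<comment> \<open>The saddle point equation writes \<open>real n\<close> as the first moment, so
      the linear part of each sine cancels and a cubic remainder is left.\<close>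
    have "S \<theta> - real n * \<theta> = (\<Sum>k. u k * sin (real k * \<theta>) - real k * u k * \<theta>)"
      unfolding S_def mean[symmetric] suminf_mult2[OF summ1]
      by (intro suminf_diff summ_sin summable_mult2 summ1)
    also have "\<bar>\<dots>\<bar> \<le> (\<Sum>k. \<theta> ^ 3 / 6 * (real k ^ 3 * u k))"
      unfolding real_norm_def[symmetric]
    proof (rule norm_suminf_le[OF _ summable_mult[OF summ]])
      fix k
      have *: "\<bar>sin (real k * \<theta>) - real k * \<theta>\<bar> \<le> (real k * \<theta>) ^ 3 / 6"
        using abs_sin_diff_self_le[of "real k * \<theta>"] that by simp
      have "\<bar>u k * sin (real k * \<theta>) - real k * u k * \<theta>\<bar> = u k * \<bar>sin (real k * \<theta>) - real k * \<theta>\<bar>"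
      proof -
        have "u k * sin (real k * \<theta>) - real k * u k * \<theta> = u k * (sin (real k * \<theta>) - real k * \<theta>)"
          by (simp add: algebra_simps)
        then show ?thesis using nonneg[of k] by (simp add: abs_mult)
      qed
      also have "\<dots> \<le> u k * ((real k * \<theta>) ^ 3 / 6)"
        by (intro mult_left_mono * nonneg)
      finally show "norm (u k * sin (real k * \<theta>) - real k * u k * \<theta>) \<le> \<theta> ^ 3 / 6 * (real k ^ 3 * u k)"
        by (simp add: power_mult_distrib mult_ac)
    qed
    finally show ?thesis by (simp only: suminf_mult[OF summ])
  qed
  have f_int: "(f m has_integral exp (- suminf u) * I m) {0..pi}" for m
  proof -
    have "f m = (\<lambda>\<theta>. exp (- suminf u) * (exp (\<Sum>k. u k * cos (real k * \<theta>)) *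
             cos ((\<Sum>k. u k * sin (real k * \<theta>)) - real m * \<theta>)))"
      by (simp add: f_def D_eq S_def fun_eq_iff exp_diff exp_minus field_simps)
    then show ?thesis using int[of m] by (auto intro: has_integral_mult_right)
  qed
  have exp_D_le1: "exp (- D \<theta>) \<le> 1" for \<theta> using D_nonneg by simp
  have exp_D_tail: "exp (- D \<theta>) \<le> E" if "\<tau> \<le> \<theta>" "\<theta> \<le> pi" for \<theta>
    using tail[OF that] by (simp add: E_def D_def)
  have cos_phase: "cos (S \<theta> - real n * \<theta>) \<ge> 1 / 2" if "0 \<le> \<theta>" "\<theta> \<le> \<tau>" for \<theta>
  proof -
    have "\<theta> ^ 3 / 6 * (\<Sum>k. real k ^ 3 * u k) \<le> \<tau> ^ 3 / 6 * (\<Sum>k. real k ^ 3 * u k)"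
      using that by (intro mult_right_mono divide_right_mono power_mono suminf_nonneg summ)
         (auto simp: nonneg)
    also have "\<dots> \<le> 1" using third by (simp add: mult.commute)
    finally have "\<bar>S \<theta> - real n * \<theta>\<bar> \<le> 1" using phase that by force
    then have "(S \<theta> - real n * \<theta>)\<^sup>2 \<le> 1"
      by (simp add: abs_square_le_1)
    then show ?thesis using one_minus_cos_le[of "S \<theta> - real n * \<theta>"] by simp
  qed

  \<comment> \<open>Subtracting \<open>E\<close> on all of [0, pi] gives a single minorant: a
    positive bound up to \<beta>, nonnegativity up to \<tau>, and modulus at most \<open>E\<close>
    beyond.\<close>
  have lower: "(if \<theta> \<in> {0..\<beta>} then exp (- H) / 2 else 0) - E \<le> f n \<theta>" if "\<theta> \<in> {0..pi}" for \<theta>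
  proof -
    consider "\<theta> \<le> \<beta>" | "\<beta> < \<theta>" "\<theta> \<le> \<tau>" | "\<tau> < \<theta>" by linarith
    then show ?thesis
    proof cases
      case 1
      have "\<theta>\<^sup>2 * (\<Sum>k. real k ^ 2 * u k) \<le> \<beta>\<^sup>2 * (\<Sum>k. real k ^ 2 * u k)"
        using 1 that by (intro mult_right_mono power_mono suminf_nonneg summ2) (auto simp: nonneg)
      then have "D \<theta> \<le> H" using D_le[of \<theta>] second by (simp add: mult.commute)
      then have "exp (- H) * (1 / 2) \<le> f n \<theta>"
        unfolding f_def using 1 \<beta> that by (intro mult_mono cos_phase) auto
      moreover have "E \<ge> 0" by (simp add: E_def)
      ultimately show ?thesis using 1 that by simp
    next
      case 2
      then have "f n \<theta> \<ge> 0" unfolding f_def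
        using \<beta> cos_phase[of \<theta>] by (intro mult_nonneg_nonneg) auto
      then show ?thesis using 2 by (auto simp: E_def intro: order_trans[of _ 0])
    next
      case 3
      have "\<bar>f n \<theta>\<bar> \<le> exp (- D \<theta>)" by (simp add: f_def abs_mult mult_left_le)
      also have "\<dots> \<le> E" using 3 that by (intro exp_D_tail) auto
      finally show ?thesis using 3 \<beta> by auto
    qed
  qed
  have "exp (- H) / 2 * \<beta> - pi * E \<le> exp (- suminf u) * I n"
  proof (rule has_integral_le[OF _ f_int lower])
    show "((\<lambda>\<theta>. (if \<theta> \<in> {0..\<beta>} then exp (- H) / 2 else 0) - E) has_integral exp (- H) / 2 * \<beta> - pi * E) {0..pi}"
      using \<beta> has_integral_const_real[of E 0 pi] by (intro has_integral_diff has_integral_step) auto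
  qed
  then show "exp (- suminf u) * I n \<ge> \<beta> * (exp (- H) / 2) - pi * exp (- T)"
    by (simp add: E_def mult.commute)

  \<comment> \<open>Passing from \<open>n\<close> to \<open>n + 1\<close> moves the phase by
    \<theta>, and cosine is 1-Lipschitz. The change is at most \<tau> on [0, \<tau>] and at most
    \<open>pi * E\<close> afterwards.\<close>
  have upper: "\<bar>f (n + 1) \<theta> - f n \<theta>\<bar> \<le> (if \<theta> \<in> {0..\<tau>} then \<tau> else 0) + pi * E" if "\<theta> \<in> {0..pi}" for \<theta>
  proof -
    have cos_lip: "\<bar>cos x - cos y\<bar> \<le> \<bar>x - y\<bar>" for x y :: real
    proof -
      have "\<bar>cos x - cos y\<bar> = 2 * (\<bar>sin ((x + y) / 2)\<bar> * \<bar>sin ((y - x) / 2)\<bar>)"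
        by (simp add: cos_diff_cos abs_mult)
      also have "\<dots> \<le> 2 * (1 * \<bar>(y - x) / 2\<bar>)"
        by (intro mult_left_mono mult_mono abs_sin_x_le_abs_x) auto
      finally show ?thesis by (simp add: abs_minus_commute)
    qed
    have "f (n + 1) \<theta> - f n \<theta> = exp (- D \<theta>) * (cos (S \<theta> - real (n + 1) * \<theta>) - cos (S \<theta> - real n * \<theta>))"
      by (simp add: f_def algebra_simps)
    also have "\<bar>\<dots>\<bar> \<le> exp (- D \<theta>) * \<theta>"
      unfolding abs_mult using that cos_lip[of "S \<theta> - real (n + 1) * \<theta>" "S \<theta> - real n * \<theta>"]
      by (intro mult_mono) (auto simp: algebra_simps)
    finally have *: "\<bar>f (n + 1) \<theta> - f n \<theta>\<bar> \<le> exp (- D \<theta>) * \<theta>" .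
    show ?thesis
    proof (cases "\<theta> \<le> \<tau>")
      case True
      have "exp (- D \<theta>) * \<theta> \<le> 1 * \<tau>"
        using True that by (intro mult_mono exp_D_le1) auto
      then show ?thesis using * True that by (simp add: E_def add_increasing2)
    next
      case False
      have "exp (- D \<theta>) * \<theta> \<le> E * pi"
        using False that by (intro mult_mono exp_D_tail) (auto simp: E_def)
      then show ?thesis using * False by (simp add: mult.commute)
    qed
  qed
  have step_int: "((\<lambda>\<theta>. (if \<theta> \<in> {0..\<tau>} then \<tau> else 0) + pi * E) has_integral \<tau> * \<tau> + pi * (pi * E)) {0..pi}"
    using \<beta> has_integral_const_real[of "pi * E" 0 pi] by (intro has_integral_add has_integral_step) auto
  have diff_int: "((\<lambda>\<theta>. f (n + 1) \<theta> - f n \<theta>) has_integral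
      exp (- suminf u) * I (n + 1) - exp (- suminf u) * I n) {0..pi}"
    by (intro has_integral_diff f_int)
  have "exp (- suminf u) * I (n + 1) - exp (- suminf u) * I n \<le> \<tau> * \<tau> + pi * (pi * E)"
    using upper by (intro has_integral_le[OF diff_int step_int]) (simp only: abs_le_iff)
  moreover have "- (exp (- suminf u) * I (n + 1) - exp (- suminf u) * I n) \<le> \<tau> * \<tau> + pi * (pi * E)"
    using upper by (intro has_integral_le[OF has_integral_neg[OF diff_int] step_int]) (simp only: abs_le_iff)
  ultimately show "\<bar>exp (- suminf u) * I (n + 1) - exp (- suminf u) * I n\<bar> \<le> \<tau>\<^sup>2 + pi\<^sup>2 * exp (- T)"
    by (simp add: E_def power2_eq_square abs_le_iff)
qed

section \<open>The ratio of consecutive coefficients\<close>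

text \<open>Intermediate value theorem for the first moment \<open>g\<close> between
  \<open>r\<^sub>0\<close> and a point close to 1. Since \<open>k * a k\<close> stays above
  \<gamma>, \<open>g\<close> exceeds every \<open>n\<close> near 1, while large \<open>n\<close>
  exceeds \<open>g r\<^sub>0\<close>; this strictness gives
  \<open>\<sigma> < \<sigma>\<^sub>0\<close>.\<close>

lemma exists_saddle_point:
  fixes a :: "nat \<Rightarrow> real"
  assumes nonneg: "\<And>k. a k \<ge> 0"
    and summ: "\<And>r. 0 < r \<Longrightarrow> r < 1 \<Longrightarrow> summable (\<lambda>k. real k * a k * r ^ k)"
    and \<gamma>: "\<gamma> > 0" and lower: "\<And>k. k \<ge> K\<^sub>0 \<Longrightarrow> \<gamma> \<le> real k * a k"
    and \<sigma>\<^sub>0: "\<sigma>\<^sub>0 > 0"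
  shows "\<forall>\<^sub>F n in sequentially. \<exists>\<sigma>. 0 < \<sigma> \<and> \<sigma> < \<sigma>\<^sub>0 \<and> (\<Sum>k. real k * (a k * exp (- \<sigma> * real k))) = real n"
proof -
  define g where "g = (\<lambda>r. \<Sum>k. real k * a k * r ^ k)"
  define r\<^sub>0 where "r\<^sub>0 = exp (- \<sigma>\<^sub>0)"
  have r0: "0 < r\<^sub>0" "r\<^sub>0 < 1" using \<sigma>\<^sub>0 by (auto simp: r\<^sub>0_def)
  have "\<forall>\<^sub>F n in sequentially. real n > g r\<^sub>0"
    using filterlim_real_sequentially by (auto simp: filterlim_at_top_dense)
  then show ?thesis
  proof eventually_elim
    case (elim n)
    obtain N where N: "real N * \<gamma> > real n"
      using reals_Archimedean3[OF \<gamma>] by blast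
    \<comment> \<open>The truncation \<open>h\<close> is a polynomial, hence continuous at 1, where
      the full series diverges. It lies below \<open>g\<close> because all terms are
      nonnegative.\<close>
    define h where "h = (\<lambda>r. \<Sum>k<K\<^sub>0 + N. real k * a k * r ^ k)"
    have "real N * \<gamma> = (\<Sum>k=K\<^sub>0..<K\<^sub>0+N. \<gamma>)" by simp
    also have "\<dots> \<le> (\<Sum>k=K\<^sub>0..<K\<^sub>0+N. real k * a k)"
      by (intro sum_mono lower) auto
    also have "\<dots> \<le> h 1"
      unfolding h_def by (auto intro!: sum_mono2 simp: nonneg)
    finally have "h 1 > real n" using N by simp
    moreover have "(h \<longlongrightarrow> h 1) (at_left 1)"
      unfolding h_def by (intro tendsto_intros)
    ultimately have "\<forall>\<^sub>F r in at_left 1. h r > real n"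
      by (rule order_tendstoD(1)[rotated])
    moreover have "\<forall>\<^sub>F r in at_left 1. r \<in> {r\<^sub>0<..<1}"
      using r0 by (intro eventually_at_left_real)
    ultimately have "\<forall>\<^sub>F r in at_left (1::real). h r > real n \<and> r \<in> {r\<^sub>0<..<1}"
      by (rule eventually_conj)
    then obtain r\<^sub>1 where r1: "h r\<^sub>1 > real n" "r\<^sub>0 < r\<^sub>1" "r\<^sub>1 < 1"
      using eventually_happens[of _ "at_left (1::real)"] by auto
    have "h r\<^sub>1 \<le> g r\<^sub>1"
      unfolding h_def g_def using r1 r0 by (intro sum_le_suminf summ) (auto simp: nonneg)
    have "isCont g r" if "r\<^sub>0 \<le> r" "r \<le> r\<^sub>1" for r
      unfolding g_def
      by (rule isCont_powser[OF summ[of "(r\<^sub>1 + 1) / 2"]]) (use that r1 r0 in auto)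
    then obtain r where r: "r\<^sub>0 \<le> r" "r \<le> r\<^sub>1" "g r = real n"
      using IVT[of g r\<^sub>0 "real n" r\<^sub>1] elim r1 \<open>h r\<^sub>1 \<le> g r\<^sub>1\<close> by force
    have "r \<noteq> r\<^sub>0" using elim r by auto
    then have "ln r\<^sub>0 < ln r" "ln r < 0" using r r0 r1 by auto
    moreover have "exp (ln r * real k) = r ^ k" for k
      using r r0 by (subst mult.commute) (simp add: exp_of_nat_mult)
    ultimately show ?case
      using r by (intro exI[of _ "- ln r"]) (simp add: r\<^sub>0_def g_def mult.assoc)
  qed
qed

text \<open>At a saddle point the ratio of the two integrals is \<open>exp (- \<sigma>)\<close>
  times the ratio of the coefficients and differs from 1 by at most \<open>R \<sigma>\<close>. Large
  \<open>n\<close> forces \<sigma> to be small, and both \<open>R \<sigma>\<close> and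
  \<open>exp \<sigma> - 1\<close> tend to 0 with \<sigma>.\<close>

lemma exp_coeff_ratio_tendsto:
  fixes a :: "nat \<Rightarrow> real"
  assumes p: "p > 0" and \<epsilon>: "0 < \<epsilon>" "\<epsilon> \<le> p / 3"
    and a0: "a 0 = 0" and nonneg: "\<And>k. a k \<ge> 0"
    and upper: "\<And>k. k \<ge> 1 \<Longrightarrow> a k \<le> \<gamma>\<^sub>2 * real k powr (p - 1)"
    and \<gamma>1: "\<gamma>\<^sub>1 > 0"
    and lower: "\<And>k. k \<ge> K\<^sub>0 \<Longrightarrow> \<gamma>\<^sub>1 * real k powr (2 * p / 3 + \<epsilon> - 1) \<le> a k"
  shows "(\<lambda>n. exp_coeff a (n + 1) / exp_coeff a n) \<longlonglongrightarrow> 1"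
proof -
  define p\<^sub>1 where "p\<^sub>1 = 2 * p / 3 + \<epsilon>"
  \<comment> \<open>The cubic phase is negligible if \<open>3 * s > p\<close>, and the damping is
    large if \<open>2 * s < p\<^sub>1\<close>. The value taken is the midpoint of the interval from
    p/3 to p/3 + \<epsilon>/2 so obtained.\<close>
  define s where "s = p / 3 + \<epsilon> / 4"
  define C\<^sub>2 where "C\<^sub>2 = \<gamma>\<^sub>2 * (4 * (2 * (p + real 2 - 1)) powr (p + real 2 - 1))"
  define C\<^sub>3 where "C\<^sub>3 = \<gamma>\<^sub>2 * (4 * (2 * (p + real 3 - 1)) powr (p + real 3 - 1))"
  define c where "c = \<gamma>\<^sub>1 * exp (- 6) / 48"
  define h where "h = exp (- (C\<^sub>2 / 2)) / 2"
  define \<tau> where "\<tau> = (\<lambda>\<sigma>::real. \<sigma> powr (1 + s))"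
  \<comment> \<open>The width at which the second moment, of order \<sigma> powr (-p - 2), times the
    square of \<beta> stays bounded.\<close>
  define \<beta> where "\<beta> = (\<lambda>\<sigma>::real. \<sigma> powr (1 + p / 2))"
  define E where "E = (\<lambda>\<sigma>. exp (- (c * \<sigma> powr (- (\<epsilon> / 2)))))"
  define R where "R = (\<lambda>\<sigma>. ((\<tau> \<sigma>)\<^sup>2 + pi\<^sup>2 * E \<sigma>) / (\<beta> \<sigma> * h - pi * E \<sigma>))"
  \<comment> \<open>These conditions hold for all small \<sigma>: the lower bound on
    \<open>a\<close> covers the damping block, the phase is at most 1 on [0, \<tau>], and the main
    term beats the tail.\<close>
  define good where "good = (\<lambda>\<sigma>. 0 < \<sigma> \<and> \<sigma> < 1 \<and> real K\<^sub>0 \<le> 1 / \<sigma> \<and>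
    C\<^sub>3 * \<sigma> powr (3 * \<epsilon> / 4) \<le> 6 \<and> 0 < \<beta> \<sigma> * h - pi * E \<sigma>)"
  have p1: "p\<^sub>1 > 0" and s: "s > 0" and c: "c > 0" and h: "h > 0"
    using p \<epsilon> \<gamma>1 by (auto simp: p\<^sub>1_def s_def c_def h_def)

  have summ_exp: "summable (\<lambda>k. real k * (a k * exp (- \<sigma> * real k)))" if "0 < \<sigma>" "\<sigma> \<le> 1" for \<sigma>
    using moment_bound(1)[OF p that order.refl nonneg upper] by simp
  have summ1: "summable (\<lambda>k. real k * a k * r ^ k)" if r: "0 < r" "r < 1" for r
  proof -
    \<comment> \<open>The cap at 1 is needed by \<open>moment_bound\<close>; a smaller
      \<open>r\<close> is compared with exp(-1).\<close>
    define \<sigma> where "\<sigma> = min 1 (- ln r)"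
    have \<sigma>: "0 < \<sigma>" "\<sigma> \<le> 1" using r by (auto simp: \<sigma>_def)
    have "r ^ k \<le> exp (- \<sigma> * real k)" for k
    proof -
      have "r ^ k = exp (real k * ln r)" using r by (simp add: exp_of_nat_mult)
      also have "real k * ln r \<le> real k * - \<sigma>"
        by (intro mult_left_mono) (auto simp: \<sigma>_def)
      finally show ?thesis by (simp add: mult.commute)
    qed
    then show ?thesis
      using r by (intro summable_comparison_test'[OF summ_exp[OF \<sigma>], of 0])
        (auto simp: nonneg abs_mult mult.assoc intro!: mult_left_mono)
  qed
  have summ: "summable (\<lambda>k. a k * r ^ k)" if r: "0 < r" "r < 1" for r
  proof (rule summable_comparison_test'[OF summ1[OF r], of 0])
    fix k :: nat
    show "norm (a k * r ^ k) \<le> real k * a k * r ^ k"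
      using r nonneg[of k] a0 mult_right_mono[of 1 "real k" "a k * r ^ k"]
      by (cases "k = 0") (auto simp: abs_mult mult.assoc)
  qed

  have ratio: "\<bar>exp (- \<sigma>) * (exp_coeff a (n + 1) / exp_coeff a n) - 1\<bar> \<le> R \<sigma>"
    if good: "good \<sigma>" and mean: "(\<Sum>k. real k * (a k * exp (- \<sigma> * real k))) = real n" for \<sigma> n
  proof -
    have \<sigma>: "0 < \<sigma>" "\<sigma> < 1" "\<sigma> \<le> 1" and K0: "real K\<^sub>0 \<le> 1 / \<sigma>"
      and C3: "C\<^sub>3 * \<sigma> powr (3 * \<epsilon> / 4) \<le> 6" and denom: "0 < \<beta> \<sigma> * h - pi * E \<sigma>"
      using good by (auto simp: good_def)
    define u where "u = (\<lambda>k. a k * exp (- \<sigma> * real k))"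
    define r where "r = exp (- \<sigma>)"
    define I where "I = (\<lambda>m. pi * (exp_coeff a m * r ^ m))"
    have r: "0 < r" "r < 1" using \<sigma> by (auto simp: r_def)
    have u_eq: "u k = a k * r ^ k" for k
      by (simp add: u_def r_def mult.commute flip: exp_of_nat_mult)
    have "s \<le> p / 2" using \<epsilon> by (simp add: s_def)
    have \<beta>\<tau>: "0 < \<beta> \<sigma>" "\<beta> \<sigma> \<le> \<tau> \<sigma>" "\<tau> \<sigma> \<le> pi"
    proof -
      show "0 < \<beta> \<sigma>" using \<sigma> by (simp add: \<beta>_def)
      show "\<beta> \<sigma> \<le> \<tau> \<sigma>" unfolding \<beta>_def \<tau>_def
        using \<sigma> \<open>s \<le> p / 2\<close> by (intro powr_mono') auto
      have "\<tau> \<sigma> \<le> 1" using \<sigma> s by (simp add: \<tau>_def powr_le1)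
      then show "\<tau> \<sigma> \<le> pi" using pi_gt3 by linarith
    qed
    have "(\<Sum>k. real k ^ 2 * u k) * \<beta> \<sigma> ^ 2 \<le> (C\<^sub>2 * \<sigma> powr (- p - real 2)) * \<beta> \<sigma> ^ 2"
      unfolding u_def C\<^sub>2_def
      by (intro mult_right_mono moment_bound(2)[OF p \<sigma>(1,3) _ nonneg upper]) auto
    also have "\<dots> = C\<^sub>2 * \<sigma> powr ((- p - real 2) + ((1 + p / 2) + (1 + p / 2)))"
      by (simp only: \<beta>_def power2_eq_square powr_add mult.assoc)
    also have "\<dots> = 2 * (C\<^sub>2 / 2)" using \<sigma> by simp
    finally have second: "(\<Sum>k. real k ^ 2 * u k) * \<beta> \<sigma> ^ 2 \<le> 2 * (C\<^sub>2 / 2)" .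
    have "(\<Sum>k. real k ^ 3 * u k) * \<tau> \<sigma> ^ 3 \<le> (C\<^sub>3 * \<sigma> powr (- p - real 3)) * \<tau> \<sigma> ^ 3"
      unfolding u_def C\<^sub>3_def
      by (intro mult_right_mono moment_bound(2)[OF p \<sigma>(1,3) _ nonneg upper]) (auto simp: \<tau>_def)
    also have "\<dots> = C\<^sub>3 * \<sigma> powr ((- p - real 3) + ((1 + s) + (1 + s) + (1 + s)))"
      by (simp only: \<tau>_def power3_eq_cube powr_add mult.assoc)
    also have "(- p - real 3) + ((1 + s) + (1 + s) + (1 + s)) = 3 * \<epsilon> / 4"
      by (simp add: s_def)
    also note C3
    finally have third: "(\<Sum>k. real k ^ 3 * u k) * \<tau> \<sigma> ^ 3 \<le> 6" .
    have tail: "c * \<sigma> powr (- (\<epsilon> / 2)) \<le> (\<Sum>k. u k * (1 - cos (real k * \<theta>)))"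
      if \<theta>: "\<tau> \<sigma> \<le> \<theta>" "\<theta> \<le> pi" for \<theta>
    proof -
      have "\<sigma> powr s \<le> \<theta> / \<sigma>"
        using \<theta> \<sigma> by (simp add: \<tau>_def powr_add field_simps)
      then have "(\<sigma> powr s)\<^sup>2 \<le> (\<theta> / \<sigma>)\<^sup>2" by (intro power_mono) auto
      moreover have "(\<sigma> powr s)\<^sup>2 \<le> 1"
        using \<sigma> s by (intro power_le_one powr_le1) auto
      ultimately have min: "(\<sigma> powr s)\<^sup>2 \<le> min 1 ((\<theta> / \<sigma>)\<^sup>2)" by simp
      have "\<sigma> powr (- (\<epsilon> / 2)) = \<sigma> powr (- p\<^sub>1 + (s + s))"
        by (simp add: p\<^sub>1_def s_def)
      also have "\<dots> = \<sigma> powr (- p\<^sub>1) * (\<sigma> powr s)\<^sup>2"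
        by (simp only: powr_add power2_eq_square)
      finally have "c * \<sigma> powr (- (\<epsilon> / 2)) = c * \<sigma> powr (- p\<^sub>1) * (\<sigma> powr s)\<^sup>2"
        by simp
      also have "\<dots> \<le> c * \<sigma> powr (- p\<^sub>1) * min 1 ((\<theta> / \<sigma>)\<^sup>2)"
        using c by (intro mult_left_mono min) auto
      also have "\<dots> \<le> (\<Sum>k. u k * (1 - cos (real k * \<theta>)))"
        unfolding u_def c_def
      proof (rule damping_lower_bound[OF p1 \<sigma>(1,3) _ \<theta>(2) nonneg])
        show "0 \<le> \<theta>" using \<theta> \<beta>\<tau> by simp
        show "\<gamma>\<^sub>1 * real k powr (p\<^sub>1 - 1) \<le> a k" if "1 / \<sigma> \<le> real k" for k
          unfolding p\<^sub>1_def using that K0 by (intro lower) simp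
        show "summable (\<lambda>k. a k * exp (- \<sigma> * real k))"
          using summ[OF r] by (simp flip: u_eq add: u_def)
      qed (use \<gamma>1 in auto)
      finally show ?thesis .
    qed
    have summ3: "summable (\<lambda>k. real k ^ 3 * u k)"
      unfolding u_def by (rule moment_bound(1)[OF p \<sigma>(1,3) _ nonneg upper]) auto
    have int: "((\<lambda>\<theta>. exp (\<Sum>k. u k * cos (real k * \<theta>)) *
             cos ((\<Sum>k. u k * sin (real k * \<theta>)) - real m * \<theta>)) has_integral I m) {0..pi}" for m
      unfolding u_eq I_def by (rule exp_coeff_has_integral[OF a0 nonneg summ r])
    have u_nonneg: "u k \<ge> 0" for k by (simp add: u_def nonneg)
    have u0: "u 0 = 0" by (simp add: u_def a0)
    have mean': "(\<Sum>k. real k * u k) = real n" using mean by (simp add: u_def)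
    note est = saddle_point_estimates[OF u_nonneg u0 summ3 mean' int \<beta>\<tau> second third tail]
    define w where "w = exp (- suminf u)"
    have lo: "w * I n \<ge> \<beta> \<sigma> * h - pi * E \<sigma>"
      using est(1) by (simp add: w_def h_def E_def)
    have up: "\<bar>w * I (n + 1) - w * I n\<bar> \<le> (\<tau> \<sigma>)\<^sup>2 + pi\<^sup>2 * E \<sigma>"
      using est(2) by (simp add: w_def E_def)
    have pos: "w * I n > 0" using lo denom by linarith
    \<comment> \<open>The lower estimate also shows that the coefficient of index \<open>n\<close>
      does not vanish, so the quotient is a genuine one.\<close>
    then have "I n \<noteq> 0" "w \<noteq> 0" by auto
    have "exp (- \<sigma>) * (exp_coeff a (n + 1) / exp_coeff a n) = I (n + 1) / I n"
      using \<open>I n \<noteq> 0\<close> r by (simp add: I_def r_def field_simps)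
    also have "\<dots> - 1 = (w * I (n + 1) - w * I n) / (w * I n)"
      using \<open>I n \<noteq> 0\<close> \<open>w \<noteq> 0\<close> by (simp add: field_simps)
    also have "\<bar>\<dots>\<bar> = \<bar>w * I (n + 1) - w * I n\<bar> / (w * I n)"
      using pos by (simp only: abs_divide abs_of_pos)
    also have "\<dots> \<le> R \<sigma>"
      unfolding R_def using lo up denom by (intro frac_le) auto
    finally show ?thesis .
  qed

  have E_lim: "((\<lambda>\<sigma>. E \<sigma> / \<beta> \<sigma>) \<longlongrightarrow> 0) (at_right 0)"
    unfolding E_def \<beta>_def using c p \<epsilon> by real_asymp
  have \<tau>_lim: "((\<lambda>\<sigma>. (\<tau> \<sigma>)\<^sup>2 / \<beta> \<sigma>) \<longlongrightarrow> 0) (at_right 0)"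
  proof -
    have "((\<lambda>\<sigma>::real. \<sigma> powr (1 + p / 6 + \<epsilon> / 2)) \<longlongrightarrow> 0) (at_right 0)"
      using p \<epsilon> by real_asymp
    moreover have "(\<tau> \<sigma>)\<^sup>2 / \<beta> \<sigma> = \<sigma> powr (1 + p / 6 + \<epsilon> / 2)" for \<sigma>
    proof -
      have "(\<tau> \<sigma>)\<^sup>2 / \<beta> \<sigma> = \<sigma> powr ((1 + s) + (1 + s) - (1 + p / 2))"
        by (simp only: \<tau>_def \<beta>_def power2_eq_square powr_add powr_diff)
      also have "(1 + s) + (1 + s) - (1 + p / 2) = 1 + p / 6 + \<epsilon> / 2"
        by (simp add: s_def)
      finally show ?thesis .
    qed
    ultimately show ?thesis by simp
  qed
  have R_lim: "(R \<longlongrightarrow> 0) (at_right 0)"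
  proof -
    \<comment> \<open>Numerator and denominator of \<open>R\<close> are divided by \<beta>; the
      quotient then tends to 0/h.\<close>
    have "((\<lambda>\<sigma>. ((\<tau> \<sigma>)\<^sup>2 / \<beta> \<sigma> + pi\<^sup>2 * (E \<sigma> / \<beta> \<sigma>)) / (h - pi * (E \<sigma> / \<beta> \<sigma>))) \<longlongrightarrow>
        (0 + pi\<^sup>2 * 0) / (h - pi * 0)) (at_right 0)"
      using h by (intro tendsto_intros \<tau>_lim E_lim) auto
    also have "(0 + pi\<^sup>2 * 0) / (h - pi * 0) = 0" by simp
    finally show ?thesis
    proof (rule Lim_transform_eventually)
      show "\<forall>\<^sub>F \<sigma> in at_right 0. ((\<tau> \<sigma>)\<^sup>2 / \<beta> \<sigma> + pi\<^sup>2 * (E \<sigma> / \<beta> \<sigma>)) / (h - pi * (E \<sigma> / \<beta> \<sigma>)) = R \<sigma>"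
        using eventually_at_right_less[of "0::real"]
      proof eventually_elim
        case (elim \<sigma>)
        then have "\<beta> \<sigma> \<noteq> 0" by (simp add: \<beta>_def)
        then have "(\<tau> \<sigma>)\<^sup>2 / \<beta> \<sigma> + pi\<^sup>2 * (E \<sigma> / \<beta> \<sigma>) = ((\<tau> \<sigma>)\<^sup>2 + pi\<^sup>2 * E \<sigma>) / \<beta> \<sigma>"
          "h - pi * (E \<sigma> / \<beta> \<sigma>) = (\<beta> \<sigma> * h - pi * E \<sigma>) / \<beta> \<sigma>"
          by (simp_all add: field_simps)
        then show ?case using \<open>\<beta> \<sigma> \<noteq> 0\<close> by (simp add: R_def)
      qed
    qed
  qed
  have good_ev: "\<forall>\<^sub>F \<sigma> in at_right 0. good \<sigma>"
  proof -
    have 1: "\<forall>\<^sub>F \<sigma> in at_right 0. \<sigma> \<in> {0<..<1::real}"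
      by (rule eventually_at_right_real) simp
    have "filterlim (\<lambda>\<sigma>::real. 1 / \<sigma>) at_top (at_right 0)" by real_asymp
    then have 2: "\<forall>\<^sub>F \<sigma> in at_right 0. real K\<^sub>0 \<le> 1 / \<sigma>"
      unfolding filterlim_at_top by blast
    have "((\<lambda>\<sigma>::real. \<sigma> powr (3 * \<epsilon> / 4)) \<longlongrightarrow> 0) (at_right 0)"
      using \<epsilon> by real_asymp
    from tendsto_mult_left[OF this, of C\<^sub>3]
    have 3: "\<forall>\<^sub>F \<sigma> in at_right 0. C\<^sub>3 * \<sigma> powr (3 * \<epsilon> / 4) < 6"
      by (rule order_tendstoD(2)) simp
    have 4: "\<forall>\<^sub>F \<sigma> in at_right 0. E \<sigma> / \<beta> \<sigma> < h / pi"
      using h by (intro order_tendstoD(2)[OF E_lim]) auto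
    show ?thesis using 1 2 3 4
    proof eventually_elim
      case (elim \<sigma>)
      then have "\<beta> \<sigma> > 0" by (simp add: \<beta>_def)
      then show ?case using elim by (simp add: good_def field_simps)
    qed
  qed

  show ?thesis
  proof (rule tendstoI)
    fix e :: real assume "e > 0"
    have "((\<lambda>\<sigma>. exp \<sigma> * R \<sigma> + \<bar>exp \<sigma> - 1\<bar>) \<longlongrightarrow> exp 0 * 0 + \<bar>exp 0 - 1\<bar>) (at_right 0)"
      by (intro tendsto_intros R_lim)
    then have "\<forall>\<^sub>F \<sigma> in at_right 0. exp \<sigma> * R \<sigma> + \<bar>exp \<sigma> - 1\<bar> < e"
      by (rule order_tendstoD(2)) (use \<open>e > 0\<close> in simp)
    with good_ev have "\<forall>\<^sub>F \<sigma> in at_right 0. good \<sigma> \<and> exp \<sigma> * R \<sigma> + \<bar>exp \<sigma> - 1\<bar> < e"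
      by (rule eventually_conj)
    then obtain \<sigma>\<^sub>0 where \<sigma>0: "\<sigma>\<^sub>0 > 0"
      "\<And>\<sigma>. 0 < \<sigma> \<Longrightarrow> \<sigma> < \<sigma>\<^sub>0 \<Longrightarrow> good \<sigma> \<and> exp \<sigma> * R \<sigma> + \<bar>exp \<sigma> - 1\<bar> < e"
      unfolding eventually_at_right_field by blast
    \<comment> \<open>The index has to be at least 1 so that its power with the positive exponent
      \<open>p\<^sub>1\<close> is at least 1.\<close>
    have lower1: "\<gamma>\<^sub>1 \<le> real k * a k" if "k \<ge> max 1 K\<^sub>0" for k
    proof -
      have "\<gamma>\<^sub>1 * 1 \<le> \<gamma>\<^sub>1 * real k powr p\<^sub>1"
        using that p1 \<gamma>1 by (intro mult_left_mono ge_one_powr_ge_zero) auto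
      also have "\<dots> = real k * (\<gamma>\<^sub>1 * real k powr (p\<^sub>1 - 1))"
        using that by (simp add: powr_diff)
      also have "\<dots> \<le> real k * a k"
        using that unfolding p\<^sub>1_def by (intro mult_left_mono lower) auto
      finally show ?thesis by simp
    qed
    have "\<forall>\<^sub>F n in sequentially. \<exists>\<sigma>. 0 < \<sigma> \<and> \<sigma> < \<sigma>\<^sub>0 \<and>
        (\<Sum>k. real k * (a k * exp (- \<sigma> * real k))) = real n"
      by (rule exists_saddle_point[OF nonneg summ1 \<gamma>1 lower1 \<sigma>0(1)])
    then show "\<forall>\<^sub>F n in sequentially. dist (exp_coeff a (n + 1) / exp_coeff a n) 1 < e"
    proof eventually_elim
      case (elim n)
      then obtain \<sigma> where \<sigma>: "0 < \<sigma>" "\<sigma> < \<sigma>\<^sub>0"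
        and mean: "(\<Sum>k. real k * (a k * exp (- \<sigma> * real k))) = real n" by blast
      define x where "x = exp_coeff a (n + 1) / exp_coeff a n"
      have "\<bar>exp (- \<sigma>) * x - 1\<bar> \<le> R \<sigma>"
        unfolding x_def using \<sigma>0(2)[OF \<sigma>] mean by (intro ratio) auto
      then have "exp \<sigma> * \<bar>exp (- \<sigma>) * x - 1\<bar> \<le> exp \<sigma> * R \<sigma>" by simp
      \<comment> \<open>This splitting removes the factor \<open>exp (- \<sigma>)\<close> from the
        ratio estimate.\<close>
      moreover have "x - 1 = exp \<sigma> * (exp (- \<sigma>) * x - 1) + (exp \<sigma> - 1)"
        by (simp add: algebra_simps exp_minus)
      then have "\<bar>x - 1\<bar> \<le> exp \<sigma> * \<bar>exp (- \<sigma>) * x - 1\<bar> + \<bar>exp \<sigma> - 1\<bar>"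
        using abs_triangle_ineq[of "exp \<sigma> * (exp (- \<sigma>) * x - 1)" "exp \<sigma> - 1"] by (simp add: abs_mult)
      ultimately have "\<bar>x - 1\<bar> < e" using \<sigma>0(2)[OF \<sigma>] by linarith
      then show ?case by (simp add: dist_real_def x_def)
    qed
  qed
qed

section \<open>Transfer to the sequence class\<close>

lemma exp_coeff_cong:
  assumes "\<And>j. j \<ge> 1 \<Longrightarrow> a j = b j"
  shows "exp_coeff a n = exp_coeff b n"
  unfolding exp_coeff_def using assms by (intro sum.cong arg_cong2[of _ _ _ _ "(/)"] prod.cong) auto

theorem mainTheorem3:
  fixes p \<epsilon> :: real and a :: "nat \<Rightarrow> real"
  assumes "p > 0" and "0 < \<epsilon>" and "\<epsilon> \<le> p / 3"
    and "a \<in> seq_class (2 * p / 3 + \<epsilon>) p"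
  shows "\<exists>L>0. (\<lambda>n. exp_coeff a n / exp_coeff a (n + 1)) \<longlonglongrightarrow> L"
proof -
  obtain \<gamma>\<^sub>1 \<gamma>\<^sub>2 where pos: "\<forall>j\<ge>1. a j > 0" and \<gamma>: "\<gamma>\<^sub>1 > 0" "\<gamma>\<^sub>2 > 0"
    and ev: "\<forall>\<^sub>F j in sequentially. \<gamma>\<^sub>1 * real j powr (2 * p / 3 + \<epsilon> - 1) \<le> a j \<and> a j \<le> \<gamma>\<^sub>2 * real j powr (p - 1)"
    using assms(4) unfolding seq_class_def by blast
  obtain N where N: "\<And>j. j \<ge> N \<Longrightarrow> \<gamma>\<^sub>1 * real j powr (2 * p / 3 + \<epsilon> - 1) \<le> a j \<and> a j \<le> \<gamma>\<^sub>2 * real j powr (p - 1)"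
    using ev unfolding eventually_sequentially by blast
  \<comment> \<open>The value at 0 is arbitrary in the class; setting it to 0 gives a power series
    without constant term and leaves the coefficients unchanged.\<close>
  define b where "b = a(0 := 0)"
  \<comment> \<open>Adding the finitely many initial quotients makes the eventual upper bound valid
    from index 1 on.\<close>
  define \<gamma> where "\<gamma> = \<gamma>\<^sub>2 + (\<Sum>k\<in>{1..N}. a k / real k powr (p - 1))"
  have sum_nonneg': "(\<Sum>k\<in>{1..N}. a k / real k powr (p - 1)) \<ge> 0"
    using pos by (intro sum_nonneg divide_nonneg_nonneg) (auto intro: less_imp_le)
  have upper: "b k \<le> \<gamma> * real k powr (p - 1)" if k: "k \<ge> 1" for k
  proof (cases "k \<le> N")
    case True
    have "a k / real k powr (p - 1) \<le> (\<Sum>k\<in>{1..N}. a k / real k powr (p - 1))"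
      using True k pos by (intro member_le_sum divide_nonneg_nonneg) (auto intro: less_imp_le)
    also have "\<dots> \<le> \<gamma>" using \<gamma> by (simp add: \<gamma>_def)
    finally show ?thesis using k by (simp add: b_def field_simps)
  next
    case False
    then have "a k \<le> \<gamma>\<^sub>2 * real k powr (p - 1)" using N by simp
    also have "\<dots> \<le> \<gamma> * real k powr (p - 1)"
      using sum_nonneg' by (intro mult_right_mono) (auto simp: \<gamma>_def)
    finally show ?thesis using k by (simp add: b_def)
  qed
  have "(\<lambda>n. exp_coeff b (n + 1) / exp_coeff b n) \<longlonglongrightarrow> 1"
  proof (rule exp_coeff_ratio_tendsto[OF assms(1-3) _ _ upper \<gamma>(1)])
    show "b k \<ge> 0" for k using pos by (cases "k = 0") (auto simp: b_def intro: less_imp_le)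
    show "\<gamma>\<^sub>1 * real k powr (2 * p / 3 + \<epsilon> - 1) \<le> b k" if "k \<ge> max 1 N" for k
      using N[of k] that by (simp add: b_def)
  qed (auto simp: b_def)
  also have "exp_coeff b = exp_coeff a"
    by (intro ext exp_coeff_cong) (simp add: b_def)
  finally have "(\<lambda>n. inverse (exp_coeff a (n + 1) / exp_coeff a n)) \<longlonglongrightarrow> inverse 1"
    by (rule tendsto_inverse) simp
  then show ?thesis by (intro exI[of _ 1]) (simp add: inverse_eq_divide)
qed

end
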